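(* Let $\lambda>0$. If $g:\mathbb{R}^{m\times n} \to \mathbb{R}$ is a seminorm which is not identically zero and $h:\mathbb{R}^{m\times n}\to\mathbb{R}$ is a norm, then for every $\mathbf{Y}\in\mathbb{R}^{m\times n}$, $$\min_{\mathbf{X}\in\mathbb{R}^{m\times n}} \max_{\boldsymbol\Delta\in\mathcal{U}_{(h,g)}} g\left(\mathbf{Y}-\mathbf{X}-\boldsymbol\Delta(\mathbf{X})\right) = \min_{\mathbf{X}\in\mathbb{R}^{m\times n}} \left[g\left(\mathbf{Y}-\mathbf{X}\right) + \lambda h\left( \mathbf{X}\right)\right].$$
   Context: A seminorm is an absolutely homogeneous real-valued function satisfying the triangle inequality (norms are included). The uncertainty set is $$\mathcal{U}_{(h,g)}:=\{\boldsymbol\Delta:\mathbb{R}^{m\times n}\to\mathbb{R}^{m\times n}\ |\ \boldsymbol\Delta\text{ linear},\ g(\boldsymbol\Delta(\mathbf{X}))\le\lambda h(\mathbf{X})\ \forall\,\mathbf{X}\in\mathbb{R}^{m\times n}\}.$$ *)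

theory Defs
  imports "HOL-Analysis.Analysis"
begin

definition is_seminorm :: "('a::real_vector \<Rightarrow> real) \<Rightarrow> bool" where
  "is_seminorm f \<longleftrightarrow>
     (\<forall>c x. f (c *\<^sub>R x) = \<bar>c\<bar> * f x) \<and> (\<forall>x y. f (x + y) \<le> f x + f y)"

definition is_norm :: "('a::real_vector \<Rightarrow> real) \<Rightarrow> bool" where
  "is_norm f \<longleftrightarrow> is_seminorm f \<and> (\<forall>x. f x = 0 \<longrightarrow> x = 0)"

definition uncertainty_set ::
  "real \<Rightarrow> (real^'n^'m \<Rightarrow> real) \<Rightarrow> (real^'n^'m \<Rightarrow> real) \<Rightarrow> (real^'n^'m \<Rightarrow> real^'n^'m) set" where
  "uncertainty_set lam h g = {\<Delta>. linear \<Delta> \<and> (\<forall>X. g (\<Delta> X) \<le> lam * h X)}"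

end

theory Submission
  imports Defs
begin

text \<open>The triangle inequality gives \<open>g (Y - X - \<Delta> X) \<le> g (Y - X) + \<lambda> h X\<close> for every
  admissible \<open>\<Delta>\<close>. Equality is attained for each \<open>X\<close> by the rank-one map
  \<open>\<Delta> Z = - \<lambda> \<phi> Z V\<close>, where \<open>\<phi>\<close> is a norming functional of \<open>h\<close> at \<open>X\<close> (obtained by separating
  \<open>X\<close> from the open \<open>h\<close>-ball of radius \<open>h X\<close>) and \<open>V\<close> is a vector with \<open>g V = 1\<close> in the direction
  of \<open>Y - X\<close>, or in any direction if \<open>g (Y - X) = 0\<close>. So the inner maximum coincides with the
  regularized objective, which has a minimizer because it is continuous and coercive.\<close>

lemma seminorm_scale: "is_seminorm f \<Longrightarrow> f (c *\<^sub>R x) = \<bar>c\<bar> * f x"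
  and seminorm_triangle: "is_seminorm f \<Longrightarrow> f (x + y) \<le> f x + f y"
  by (simp_all add: is_seminorm_def)

lemma seminorm_zero: "is_seminorm f \<Longrightarrow> f 0 = 0"
  using seminorm_scale[of f 0 0] by simp

lemma seminorm_minus: "is_seminorm f \<Longrightarrow> f (- x) = f x"
  using seminorm_scale[of f "-1" x] by simp

lemma seminorm_nonneg: "is_seminorm f \<Longrightarrow> 0 \<le> f x"
  using seminorm_triangle[of f x "- x"] by (simp add: seminorm_zero seminorm_minus)

lemma seminorm_triangle_diff: "is_seminorm f \<Longrightarrow> f (x - y) \<le> f x + f y"
  using seminorm_triangle[of f x "- y"] by (simp add: seminorm_minus)

lemma seminorm_abs_diff_le:
  assumes "is_seminorm f"
  shows "\<bar>f x - f y\<bar> \<le> f (x - y)"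
  using seminorm_triangle[OF assms, of "x - y" y] seminorm_triangle[OF assms, of "y - x" x]
    seminorm_minus[OF assms, of "x - y"] by simp

lemma norm_imp_seminorm: "is_norm f \<Longrightarrow> is_seminorm f"
  by (simp add: is_norm_def)

lemma norm_pos: "is_norm f \<Longrightarrow> x \<noteq> 0 \<Longrightarrow> 0 < f x"
  using seminorm_nonneg[of f x] by (auto simp: is_norm_def less_le)

lemma seminorm_sum_le:
  assumes "is_seminorm f"
  shows "f (\<Sum>i\<in>A. u i) \<le> (\<Sum>i\<in>A. f (u i))"
proof (induction A rule: infinite_finite_induct)
  case (insert i A)
  then show ?case
    using seminorm_triangle[OF assms, of "u i" "\<Sum>i\<in>A. u i"] by simp
qed (simp_all add: seminorm_zero[OF assms])

text \<open>Expand \<open>x\<close> in the standard basis, apply the triangle inequality, and bound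
  each coordinate by \<open>norm x\<close>. The resulting constant is the Lipschitz constant that
  makes every seminorm continuous.\<close>

lemma seminorm_le_norm:
  fixes f :: "'a::euclidean_space \<Rightarrow> real"
  assumes f: "is_seminorm f"
  shows "f x \<le> (\<Sum>b\<in>Basis. f b) * norm x"
proof -
  have "f x = f (\<Sum>b\<in>Basis. (x \<bullet> b) *\<^sub>R b)"
    by (simp add: euclidean_representation)
  also have "\<dots> \<le> (\<Sum>b\<in>Basis. f ((x \<bullet> b) *\<^sub>R b))"
    by (rule seminorm_sum_le[OF f])
  also have "\<dots> \<le> (\<Sum>b\<in>Basis. f b * norm x)"
    by (intro sum_mono)
      (simp add: seminorm_scale[OF f] mult.commute[of "f _"] mult_right_mono Basis_le_norm
        seminorm_nonneg[OF f])
  finally show ?thesis by (simp add: sum_distrib_right)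
qed

lemma continuous_on_seminorm:
  fixes f :: "'a::euclidean_space \<Rightarrow> real"
  assumes f: "is_seminorm f"
  shows "continuous_on S f"
proof (rule lipschitz_on_continuous_on)
  show "(\<Sum>b\<in>Basis. f b)-lipschitz_on S f"
  proof (rule lipschitz_onI)
    show "dist (f x) (f y) \<le> (\<Sum>b\<in>Basis. f b) * dist x y" for x y
      using seminorm_abs_diff_le[OF f, of x y] seminorm_le_norm[OF f, of "x - y"]
      by (simp add: dist_norm)
  qed (simp add: sum_nonneg seminorm_nonneg[OF f])
qed

text \<open>The constant is the minimum of \<open>h\<close> on the compact unit sphere, positive by
  definiteness; homogeneity carries the bound to all vectors.\<close>

lemma norm_coercive:
  fixes h :: "'a::euclidean_space \<Rightarrow> real"
  assumes h: "is_norm h"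
  obtains c where "c > 0" "\<And>x. c * norm x \<le> h x"
proof -
  obtain u where u: "norm u = 1" "\<And>x. norm x = 1 \<Longrightarrow> h u \<le> h x"
    using continuous_attains_inf[of "sphere (0::'a) 1" h]
      continuous_on_seminorm[OF norm_imp_seminorm[OF h]] by auto
  show thesis
  proof
    show "h u > 0" using u(1) by (intro norm_pos[OF h]) auto
    show "h u * norm x \<le> h x" for x
    proof (cases "x = 0")
      case True
      then show ?thesis by (simp add: seminorm_zero[OF norm_imp_seminorm[OF h]])
    next
      case False
      then have "h u \<le> h ((1 / norm x) *\<^sub>R x)" by (intro u(2)) simp
      then show ?thesis
        using False by (simp add: seminorm_scale[OF norm_imp_seminorm[OF h]] field_simps)
    qed
  qed
qed

lemma norming_functional:
  fixes h :: "'a::euclidean_space \<Rightarrow> real"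
  assumes h: "is_norm h" and "X \<noteq> 0"
  obtains \<phi> where "linear \<phi>" "\<phi> X = h X" "\<And>Z. \<bar>\<phi> Z\<bar> \<le> h Z"
proof -
  note sn = norm_imp_seminorm[OF h]
  have hX: "h X > 0" using norm_pos[OF h \<open>X \<noteq> 0\<close>] .
  have "convex {Z. h Z < h X}"
  proof (rule convexI, simp)
    fix x y and u v :: real
    assume *: "h x < h X" "h y < h X" "0 \<le> u" "0 \<le> v" "u + v = 1"
    have "h (u *\<^sub>R x + v *\<^sub>R y) \<le> u * h x + v * h y"
      using seminorm_triangle[OF sn, of "u *\<^sub>R x" "v *\<^sub>R y"] * by (simp add: seminorm_scale[OF sn])
    also have "\<dots> < h X" using * by (rule convex_bound_lt)
    finally show "h (u *\<^sub>R x + v *\<^sub>R y) < h X" .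
  qed
  moreover have "{Z. h Z < h X} \<noteq> {}" using hX seminorm_zero[OF sn] by (auto intro: exI[of _ 0])
  ultimately obtain a b where "a \<noteq> 0" and "\<And>Z. h Z < h X \<Longrightarrow> a \<bullet> Z \<le> b" and "b \<le> a \<bullet> X"
    using separating_hyperplane_sets[of "{Z. h Z < h X}" "{X}"] by auto
  then have sep: "a \<bullet> Z \<le> a \<bullet> X" if "h Z < h X" for Z
    using that by (meson order_trans)
  \<comment> \<open>Separation gives only a weak inequality. For strict positivity, test it on a
    small multiple of \<open>a\<close>: the choice of \<open>e\<close> gives
    \<open>h (e *\<^sub>R a) = h X / 2\<close>, so this point lies in the open ball.\<close>
  have aX: "a \<bullet> X > 0"
  proof -
    have ha: "h a > 0" using norm_pos[OF h \<open>a \<noteq> 0\<close>] .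
    define e where "e = h X / (2 * h a)"
    have "e > 0" using ha hX by (simp add: e_def)
    have "h (e *\<^sub>R a) < h X" using ha hX by (simp add: seminorm_scale[OF sn] e_def)
    then have "e * (a \<bullet> a) \<le> a \<bullet> X" using sep by fastforce
    moreover have "e * (a \<bullet> a) > 0" using \<open>e > 0\<close> \<open>a \<noteq> 0\<close> by simp
    ultimately show ?thesis by simp
  qed
  \<comment> \<open>The separating functional, rescaled to take the value \<open>h X\<close> at
    \<open>X\<close>.\<close>
  define \<phi> where "\<phi> Z = h X / (a \<bullet> X) * (a \<bullet> Z)" for Z
  have le: "\<phi> Z \<le> h Z" for Z
  proof (cases "Z = 0")
    case True
    then show ?thesis by (simp add: \<phi>_def seminorm_zero[OF sn])
  next
    case False
    then have hZ: "h Z > 0" by (rule norm_pos[OF h])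
    show ?thesis
    \<comment> \<open>\<open>sep\<close> covers only the open ball, so \<open>Z\<close> is rescaled
      to \<open>h\<close>-length \<open>t * h X\<close> with t < 1; the bound follows as t tends to
      1.\<close>
    proof (rule field_le_mult_one_interval)
      fix t :: real assume t: "0 < t" "t < 1"
      have "h ((t * h X / h Z) *\<^sub>R Z) < h X" using t hX hZ by (simp add: seminorm_scale[OF sn])
      then have "t * h X / h Z * (a \<bullet> Z) \<le> a \<bullet> X" using sep by fastforce
      then show "t * \<phi> Z \<le> h Z" using hZ aX by (simp add: \<phi>_def field_simps)
    qed
  qed
  show thesis
  proof
    show "linear \<phi>" by (rule linearI) (simp_all add: \<phi>_def inner_add_right algebra_simps add_divide_distrib)
    show "\<phi> X = h X" using aX by (simp add: \<phi>_def)
    show "\<bar>\<phi> Z\<bar> \<le> h Z" for Z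
      using le[of Z] le[of "- Z"] by (simp add: \<phi>_def seminorm_minus[OF sn] abs_le_iff)
  qed
qed

lemma uncertainty_upper_bound:
  assumes "is_seminorm g" "\<Delta> \<in> uncertainty_set lam h g"
  shows "g (W - \<Delta> X) \<le> g W + lam * h X"
proof -
  have "g (\<Delta> X) \<le> lam * h X" using assms(2) by (simp add: uncertainty_set_def)
  then show ?thesis using seminorm_triangle_diff[OF assms(1), of W "\<Delta> X"] by linarith
qed

lemma uncertainty_bound_attained:
  fixes g h :: "real^'n^'m \<Rightarrow> real"
  assumes lam: "lam > 0" and g: "is_seminorm g" and ne: "\<exists>X. g X \<noteq> 0" and h: "is_norm h"
  obtains \<Delta> where "\<Delta> \<in> uncertainty_set lam h g" "g (W - \<Delta> X) = g W + lam * h X"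
proof -
  have hnn: "0 \<le> h Z" for Z using seminorm_nonneg[OF norm_imp_seminorm[OF h]] .
  \<comment> \<open>Moving from \<open>W\<close> by \<open>lam * h X\<close> along \<open>V\<close>
    must raise \<open>g\<close> by the full length of the move.\<close>
  have "\<exists>V. g V = 1 \<and> g W + lam * h X \<le> g (W + (lam * h X) *\<^sub>R V)"
  proof (cases "g W = 0")
    case True
    obtain U where U: "g U \<noteq> 0" using ne by blast
    define V where "V = (1 / g U) *\<^sub>R U"
    have V: "g V = 1"
      using U seminorm_nonneg[OF g, of U] by (simp add: V_def seminorm_scale[OF g])
    \<comment> \<open>Here \<open>W\<close> may be nonzero and still cannot be normalized. Since
      \<open>g W = 0\<close>, adding \<open>W\<close> does not change \<open>g\<close>, so any unit
      direction serves.\<close>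
    have "g ((lam * h X) *\<^sub>R V) \<le> g (W + (lam * h X) *\<^sub>R V) + g W"
      using seminorm_triangle_diff[OF g, of "W + (lam * h X) *\<^sub>R V" W] by simp
    then show ?thesis
      using True V lam hnn[of X] by (intro exI[of _ V]) (simp add: seminorm_scale[OF g])
  next
    case False
    then have gW: "g W > 0" using seminorm_nonneg[OF g, of W] by simp
    define V where "V = (1 / g W) *\<^sub>R W"
    have V: "g V = 1" using gW by (simp add: V_def seminorm_scale[OF g])
    \<comment> \<open>\<open>W\<close> is \<open>g W\<close> times \<open>V\<close>, so both
      summands are nonnegative multiples of \<open>V\<close> and \<open>g\<close> is additive on
      them.\<close>
    have "W + (lam * h X) *\<^sub>R V = (g W + lam * h X) *\<^sub>R V"
      using gW by (simp add: V_def add_divide_distrib scaleR_add_left)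
    then have "g (W + (lam * h X) *\<^sub>R V) = g W + lam * h X"
      using V gW lam hnn[of X] by (simp add: seminorm_scale[OF g])
    with V show ?thesis by auto
  qed
  then obtain V where V: "g V = 1" "g W + lam * h X \<le> g (W + (lam * h X) *\<^sub>R V)" by blast
  obtain \<phi> where \<phi>: "linear \<phi>" "\<phi> X = h X" "\<And>Z. \<bar>\<phi> Z\<bar> \<le> h Z"
  \<comment> \<open>At \<open>X = 0\<close> the open ball of radius \<open>h X\<close> is empty and
    leaves nothing to separate; the zero functional serves instead.\<close>
  proof (cases "X = 0")
    case True
    then show thesis
      using that[of "\<lambda>_. 0"] hnn seminorm_zero[OF norm_imp_seminorm[OF h]]
      by (simp add: linear_zero)
  next
    case False
    then show thesis using norming_functional[OF h] that by blast
  qed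
  \<comment> \<open>The minus sign makes \<open>W - \<Delta> X\<close> equal to
    \<open>W + (lam * h X) *\<^sub>R V\<close>.\<close>
  define \<Delta> where "\<Delta> Z = - (lam * \<phi> Z) *\<^sub>R V" for Z
  have mem: "\<Delta> \<in> uncertainty_set lam h g"
    unfolding uncertainty_set_def
  proof (intro CollectI conjI allI)
    show "linear \<Delta>"
      by (rule linearI)
        (simp_all add: \<Delta>_def linear_add[OF \<phi>(1)] linear_scale[OF \<phi>(1)] algebra_simps)
    show "g (\<Delta> Z) \<le> lam * h Z" for Z
      using \<phi>(3)[of Z] lam V(1)
      by (simp add: \<Delta>_def seminorm_minus[OF g] seminorm_scale[OF g] abs_mult)
  qed
  have "g (W - \<Delta> X) = g W + lam * h X"
    using uncertainty_upper_bound[OF g mem, of W X] V(2) by (simp add: \<Delta>_def \<phi>(2))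
  with mem show thesis by (rule that)
qed

text \<open>Outside a large enough closed ball the objective exceeds its value at 0, so a minimizer
  over that compact ball is global.\<close>

lemma regularized_minimum_exists:
  fixes g h :: "'a::euclidean_space \<Rightarrow> real"
  assumes lam: "lam > 0" and g: "is_seminorm g" and h: "is_norm h"
  obtains X where "\<And>Z. g (Y - X) + lam * h X \<le> g (Y - Z) + lam * h Z"
proof -
  define F where "F X = g (Y - X) + lam * h X" for X
  obtain c where c: "c > 0" "\<And>x. c * norm x \<le> h x" using norm_coercive[OF h] by blast
  \<comment> \<open>Chosen so that \<open>norm Z > R\<close> forces
    \<open>lam * c * norm Z > F 0\<close>, while the left side is at most \<open>F Z\<close> by
    coercivity.\<close>
  define R where "R = F 0 / (lam * c)"
  have "0 \<le> F 0"
    using seminorm_nonneg[OF g] seminorm_zero[OF norm_imp_seminorm[OF h]] by (simp add: F_def)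
  then have "R \<ge> 0" using c(1) lam by (simp add: R_def)
  have "continuous_on (cball 0 R) F"
    unfolding F_def
    by (intro continuous_intros continuous_on_compose2[OF continuous_on_seminorm[OF g, of UNIV]]
        continuous_on_seminorm norm_imp_seminorm[OF h]) auto
  with \<open>R \<ge> 0\<close> obtain X where X: "\<And>Z. norm Z \<le> R \<Longrightarrow> F X \<le> F Z"
    using continuous_attains_inf[of "cball 0 R" F] by (auto simp: Ball_def)
  have "F X \<le> F Z" for Z
  proof (cases "norm Z \<le> R")
    case False
    then have "F 0 \<le> lam * (c * norm Z)" using c(1) lam by (simp add: R_def field_simps)
    also have "\<dots> \<le> lam * h Z" using c(2) lam by simp
    also have "\<dots> \<le> F Z" using seminorm_nonneg[OF g] by (simp add: F_def)
    finally show ?thesis using X[of 0] \<open>R \<ge> 0\<close> by simp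
  qed (rule X)
  then show thesis using that[of X] by (simp add: F_def)
qed

theorem theorem6:
  fixes lam :: real
    and g h :: "real^'n^'m \<Rightarrow> real"
    and Y :: "real^'n^'m"
  assumes "lam > 0"
    and "is_seminorm g"
    and "\<exists>X. g X \<noteq> 0"
    and "is_norm h"
  shows "(\<forall>X. \<exists>\<Delta>. is_arg_max (\<lambda>\<Delta>. g (Y - X - \<Delta> X)) (\<lambda>\<Delta>. \<Delta> \<in> uncertainty_set lam h g) \<Delta>) \<and>
         (\<exists>X. is_arg_min (\<lambda>X. SUP \<Delta>\<in>uncertainty_set lam h g. g (Y - X - \<Delta> X)) (\<lambda>_. True) X) \<and>
         (\<exists>X. is_arg_min (\<lambda>X. g (Y - X) + lam * h X) (\<lambda>_. True) X) \<and>
         (INF X. SUP \<Delta>\<in>uncertainty_set lam h g. g (Y - X - \<Delta> X)) =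
         (INF X. g (Y - X) + lam * h X)"
proof -
  note upper = uncertainty_upper_bound[OF assms(2)]
  have attained: "\<exists>\<Delta>\<in>uncertainty_set lam h g. g (Y - X - \<Delta> X) = g (Y - X) + lam * h X" for X
    using uncertainty_bound_attained[OF assms] by metis
  \<comment> \<open>The upper bound is itself one of the values, so the real supremum is a genuine
    maximum.\<close>
  have SUP_eq: "(SUP \<Delta>\<in>uncertainty_set lam h g. g (Y - X - \<Delta> X)) = g (Y - X) + lam * h X" for X
    by (rule cSup_eq_maximum) (use attained[of X] upper in \<open>force+\<close>)
  have arg_max: "\<exists>\<Delta>. is_arg_max (\<lambda>\<Delta>. g (Y - X - \<Delta> X)) (\<lambda>\<Delta>. \<Delta> \<in> uncertainty_set lam h g) \<Delta>" for X
    using attained[of X] upper by (fastforce simp: is_arg_max_def not_less)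
  have arg_min: "\<exists>X. is_arg_min (\<lambda>X. g (Y - X) + lam * h X) (\<lambda>_. True) X"
  proof -
    obtain X where "\<And>Z. g (Y - X) + lam * h X \<le> g (Y - Z) + lam * h Z"
      using regularized_minimum_exists[OF assms(1,2,4)] by blast
    then show ?thesis by (auto simp: is_arg_min_def not_less)
  qed
  show ?thesis
    \<comment> \<open>Rewriting under the binder turns the robust objective into the regularized
      one: the two minimization claims coincide and the equation of infima becomes
      reflexive.\<close>
    unfolding SUP_eq using arg_max arg_min by simp
qed

end
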